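(* Let $\mathcal{H}$ be a real Hilbert space, $C \subseteq \mathcal{H}$ a nonempty closed convex set, and $f = f_1 + f_2$ where $f_1, f_2 : \mathcal{H} \times \mathcal{H} \to \mathbb{R} \cup \{+\infty\}$ are finite on $C \times C$ and satisfy $f_1(x,x) = f_2(x,x) = 0$ for every $x \in C$. Consider the equilibrium problem $(EP)$: find $x \in C$ such that $f(x,y) \ge 0$ for all $y \in C$, and suppose that its solution set $S(C,f)$ is nonempty. Assume: (A1) for each $i = 1,2$ and each $x \in C$, the function $f_i(x,\cdot)$ is convex and subdifferentiable, and for each $y \in C$ the function $f(\cdot, y)$ is weakly upper semicontinuous on $C$; (A2) if $\{x^k\} \subset C$ is a bounded sequence, then for each $i = 1,2$, every sequence $\{g_i^k\}$ with $g_i^k \in \partial_2 f_i(x^k, x^k)$ for all $k$ is bounded; (A3) $f$ is monotone on $C$. Suppose in addition that $f$ is paramonotone on $C$ (with respect to $S(C,f)$), and that either $\operatorname{int} C \neq \emptyset$ or for each $x \in C$ both functions $f_1(x,\cdot)$ and $f_2(x,\cdot)$ are continuous at a point in $C$. Let $\{\beta_k\}_{k \ge 0}$ be a sequence of positive real numbers with $\sum_{k=0}^\infty \beta_k = +\infty$ and $\sum_{k=0}^\infty \beta_k^2 < +\infty$, and let $\{x^k\}$ be any sequence generated by the splitting algorithm: $x^0 \in C$ is arbitrary and, for $k = 0, 1, \ldots$, take any $g_1^k \in \partial_2 f_1(x^k,x^k)$ and $g_2^k \in \partial_2 f_2(x^k,x^k)$ and compute $$\eta_k := \max\{\beta_k,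 \|g_1^k\|, \|g_2^k\|\}, \qquad \lambda_k := \frac{\beta_k}{\eta_k},$$ $$y^k := \arg\min\left\{\lambda_k f_1(x^k,y) + \tfrac12 \|y - x^k\|^2 \;:\; y \in C\right\},$$ $$x^{k+1} := \arg\min\left\{\lambda_k f_2(x^k,y) + \tfrac12 \|y - y^k\|^2 \;:\; y \in C\right\}.$$ Then the sequence $\{x^k\}$ converges weakly to a solution of $(EP)$. Moreover, if $f$ is strongly pseudo-monotone on $C$, then $\{x^k\}$ converges strongly to the unique solution of $(EP)$.
   Context: $\langle\cdot,\cdot\rangle$ and $\|\cdot\|$ denote the inner product and norm of $\mathcal{H}$. For $x \in C$, $\partial_2 f_i(x,x)$ denotes the convex subdifferential of the function $f_i(x,\cdot)$ at the point $x$, i.e. the set of $g \in \mathcal{H}$ with $f_i(x,y) \ge f_i(x,x) + \langle g, y - x\rangle$ for all $y \in \mathcal{H}$. "Subdifferentiable" means that the convex subdifferential of $f_i(x,\cdot)$ is nonempty at each point of $C$. The bifunction $f$ is monotone on $C$ if $f(x,y) + f(y,x) \le 0$ for all $x,y \in C$. It is strongly pseudo-monotone on $C$ (with modulus $\beta > 0$) if there is $\beta>0$ such that for all $x,y \in C$, $f(x,y) \ge 0$ implies $f(y,x) \le -\beta \|y-x\|^2$. It is paramonotone on $C$ with respect to a set $S$ if $x^* \in S$, $x \in C$ and $f(x^*,x) = f(x,x^* ) = 0$ imply $x \in S$. Here $S = S(C,f) := \{x \in C : f(x,y) \ge 0 \ \forall y \in C\}$. *)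

theory Defs
  imports "HOL-Analysis.Analysis"
begin

text \<open>
  Functions into the real line extended by plus infinity are modelled as \<^typ>\<open>ereal\<close>-valued
  functions; that the value minus infinity is not attained is a separate hypothesis where it
  is needed. Real Hilbert spaces are the types of sort \<open>{real_inner, complete_space}\<close>.
\<close>

text \<open>
  The coarsest topology making all functionals \<open>x \<mapsto> \<langle>x, u\<rangle>\<close> continuous. In a Hilbert space these
  are all the continuous linear functionals.
\<close>

definition weak_topology :: "'a::real_inner topology" where
  "weak_topology = topology_generated_by {(\<lambda>x. x \<bullet> u) -` V | u V. open V}"

lemma topspace_weak_topology [simp]: "topspace weak_topology = UNIV"
proof -
  have "(\<lambda>x::'a. x \<bullet> 0) -` UNIV \<in> {(\<lambda>x. x \<bullet> u) -` V | u V. open V}"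
    by blast
  then show ?thesis
    unfolding weak_topology_def topology_generated_by_topspace by auto
qed

lemma limitin_weak_topology_iff:
  "limitin weak_topology x l F \<longleftrightarrow> (\<forall>u. ((\<lambda>k. x k \<bullet> u) \<longlongrightarrow> l \<bullet> u) F)"
proof
  assume lim: "limitin weak_topology x l F"
  show "\<forall>u. ((\<lambda>k. x k \<bullet> u) \<longlongrightarrow> l \<bullet> u) F"
  proof (intro allI topological_tendstoI)
    fix u and V :: "real set"
    assume V: "open V" "l \<bullet> u \<in> V"
    have "openin weak_topology ((\<lambda>x. x \<bullet> u) -` V)"
      unfolding weak_topology_def using V(1) by (intro topology_generated_by_Basis) blast
    with lim V(2) show "\<forall>\<^sub>F k in F. x k \<bullet> u \<in> V"
      by (auto simp: limitin_def)
  qed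
next
  assume *: "\<forall>u. ((\<lambda>k. x k \<bullet> u) \<longlongrightarrow> l \<bullet> u) F"
  have "\<forall>\<^sub>F k in F. x k \<in> U"
    if "generate_topology_on {(\<lambda>x. x \<bullet> u) -` V | u V. open V} U" "l \<in> U" for U
    using that
  proof (induction rule: generate_topology_on.induct)
    case (Int a b)
    then show ?case by (auto intro: eventually_conj)
  next
    case (UN K)
    then obtain k where k: "k \<in> K" "l \<in> k" by auto
    then have "\<forall>\<^sub>F i in F. x i \<in> k" using UN by blast
    then show ?case by (rule eventually_mono) (use k in blast)
  next
    case (Basis s)
    then obtain u V where "s = (\<lambda>x. x \<bullet> u) -` V" "open V" by blast
    with Basis * show ?case by (auto dest!: spec[of _ u] topological_tendstoD)
  qed auto
  then have "\<forall>\<^sub>F k in F. x k \<in> U" if "openin weak_topology U" "l \<in> U" for U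
    using that unfolding weak_topology_def openin_topology_generated_by_iff by blast
  then show "limitin weak_topology x l F"
    by (simp add: limitin_def)
qed

definition weakly_usc_on :: "'a::real_inner set \<Rightarrow> ('a \<Rightarrow> ereal) \<Rightarrow> bool" where
  "weakly_usc_on C \<phi> \<longleftrightarrow>
     (\<forall>a. openin (subtopology weak_topology C) {x \<in> C. \<phi> x < a})"

definition convex_fun :: "('a::real_vector \<Rightarrow> ereal) \<Rightarrow> bool" where
  "convex_fun \<phi> \<longleftrightarrow>
     (\<forall>x y. \<forall>t\<in>{0<..<1::real}.
        \<phi> ((1 - t) *\<^sub>R x + t *\<^sub>R y) \<le> ereal (1 - t) * \<phi> x + ereal t * \<phi> y)"

definition subdiff :: "('a::real_inner \<Rightarrow> ereal) \<Rightarrow> 'a \<Rightarrow> 'a set" where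
  "subdiff \<phi> x = {g. \<forall>y. \<phi> y \<ge> \<phi> x + ereal (g \<bullet> (y - x))}"

definition subdifferentiable_on :: "'a::real_inner set \<Rightarrow> ('a \<Rightarrow> ereal) \<Rightarrow> bool" where
  "subdifferentiable_on C \<phi> \<longleftrightarrow> (\<forall>x\<in>C. subdiff \<phi> x \<noteq> {})"

definition EP_solutions :: "'a set \<Rightarrow> ('a \<Rightarrow> 'a \<Rightarrow> ereal) \<Rightarrow> 'a set" where
  "EP_solutions C f = {x \<in> C. \<forall>y\<in>C. f x y \<ge> 0}"

definition monotone_bifun :: "'a set \<Rightarrow> ('a \<Rightarrow> 'a \<Rightarrow> ereal) \<Rightarrow> bool" where
  "monotone_bifun C f \<longleftrightarrow> (\<forall>x\<in>C. \<forall>y\<in>C. f x y + f y x \<le> 0)"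

definition strongly_pseudomonotone ::
    "'a::real_normed_vector set \<Rightarrow> ('a \<Rightarrow> 'a \<Rightarrow> ereal) \<Rightarrow> bool" where
  "strongly_pseudomonotone C f \<longleftrightarrow>
     (\<exists>\<beta>>0. \<forall>x\<in>C. \<forall>y\<in>C. f x y \<ge> 0 \<longrightarrow> f y x \<le> ereal (- \<beta> * (norm (y - x))\<^sup>2))"

definition paramonotone :: "'a set \<Rightarrow> 'a set \<Rightarrow> ('a \<Rightarrow> 'a \<Rightarrow> ereal) \<Rightarrow> bool" where
  "paramonotone C S f \<longleftrightarrow>
     (\<forall>z\<in>S. \<forall>x\<in>C. f z x = 0 \<and> f x z = 0 \<longrightarrow> x \<in> S)"

end

theory Submission
  imports Defs "HOL-Complex_Analysis.Great_Picard"
begin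

text \<open>
  Two proximal steps turn \<open>x\<^sub>k\<close> into \<open>x\<^sub>k\<^sub>+\<^sub>1\<close>. Adding their variational inequalities, and bounding
  \<open>f\<^sub>1(x\<^sub>k, y\<^sub>k)\<close> and \<open>f\<^sub>2(x\<^sub>k, x\<^sub>k\<^sub>+\<^sub>1)\<close> from below by subgradients, gives (lemma \<open>splitting_step\<close>) for
  all \<open>u\<close> in \<open>C\<close>
  
      \<open>\<parallel>x\<^sub>k\<^sub>+\<^sub>1 - u\<parallel>\<^sup>2 \<le> \<parallel>x\<^sub>k - u\<parallel>\<^sup>2 + 2 \<lambda>\<^sub>k f(x\<^sub>k, u) + 5 \<beta>\<^sub>k\<^sup>2\<close>   and   \<open>\<parallel>x\<^sub>k\<^sub>+\<^sub>1 - x\<^sub>k\<parallel> \<le> 2 \<beta>\<^sub>k\<close>.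
  
  The normalisation by \<open>\<eta>\<^sub>k\<close> serves to make \<open>\<lambda>\<^sub>k\<close> times a subgradient at most \<open>\<beta>\<^sub>k\<close>. At a solution
  \<open>u = z\<close>, monotonicity makes \<open>d\<^sub>k = - f(x\<^sub>k, z)\<close> nonnegative, so the distances to \<open>z\<close> converge and
  \<open>\<Sum>\<lambda>\<^sub>k d\<^sub>k < \<infinity>\<close> (lemma \<open>quasi_fejer\<close>). The iterates are then bounded, hence so are the subgradients
  and \<open>\<eta>\<^sub>k\<close>, and therefore \<open>\<Sum>\<beta>\<^sub>k d\<^sub>k < \<infinity>\<close>.
  
  Since \<open>\<Sum>\<beta>\<^sub>k = \<infinity>\<close>, some subsequence has \<open>d\<^sub>k \<rightarrow> 0\<close>, and upper semicontinuity with paramonotonicity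
  puts its weak cluster points in the solution set. Weak convergence of the whole sequence by Opial's
  argument requires this of \<^emph>\<open>every\<close> weak cluster point \<open>w\<close>, along which \<open>d\<^sub>k\<close> need not tend to \<open>0\<close>.
  The idea that closes the gap is due to Bruck, who used it for demipositive semigroups. While \<open>d\<close>
  stays above \<open>\<epsilon>\<close>, the sum of the step sizes is at most \<open>1/\<epsilon>\<close> times a tail of \<open>\<Sum>\<beta>\<^sub>k d\<^sub>k\<close>, and \<open>x\<close> moves
  by no more than twice that sum. So a late iterate has, within any given distance \<open>\<delta>\<close>, a later one
  with small \<open>d\<close> (lemma \<open>nearby_small_value\<close>). Hence there is a solution within \<open>\<delta>\<close> of \<open>w\<close>, for each
  \<open>\<delta>\<close>, and the solution set is closed.
  
  Under strong pseudo-monotonicity \<open>d\<^sub>k\<close> dominates a multiple of \<open>\<parallel>x\<^sub>k - z\<parallel>\<^sup>2\<close>; since \<open>d\<^sub>k\<close> is arbitrarily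
  small infinitely often, the limit of the convergent distances \<open>\<parallel>x\<^sub>k - z\<parallel>\<close> is \<open>0\<close>.
\<close>

section \<open>Weak sequential compactness in Hilbert spaces\<close>

text \<open>
  Elements of nearly minimal norm in the \<open>D n\<close> form a Cauchy sequence: the midpoint of two of them lies
  in the same convex set, so its norm is not much smaller, and the parallelogram law bounds their
  distance. The common point is the limit.
\<close>

lemma decseq_bounded_closed_convex_Inter_nonempty:
  fixes D :: "nat \<Rightarrow> 'a::{real_inner, complete_space} set"
  assumes dec: "decseq D" and ne: "\<And>n. D n \<noteq> {}" and cl: "\<And>n. closed (D n)"
    and cv: "\<And>n. convex (D n)" and bd: "bounded (D 0)"
  shows "(\<Inter>n. D n) \<noteq> {}"
proof -
  obtain B where B: "\<And>v. v \<in> D 0 \<Longrightarrow> norm v \<le> B"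
    using bd bounded_iff by blast
  have sub: "D n \<subseteq> D m" if "m \<le> n" for m n
    using dec that by (auto simp: decseq_def)
  define m where "m n = (INF v\<in>D n. (norm v)\<^sup>2)" for n
  have bdd: "bdd_below ((\<lambda>v. (norm v)\<^sup>2) ` D n)" for n
    by (intro bdd_belowI[of _ 0]) auto
  have m_le: "m n \<le> (norm v)\<^sup>2" if "v \<in> D n" for n v
    unfolding m_def using bdd that by (intro cINF_lower) auto
  have "\<exists>v\<in>D n. (norm v)\<^sup>2 < m n + 1 / real (Suc n)" for n
  proof -
    have "m n < m n + 1 / real (Suc n)" by simp
    then show ?thesis
      unfolding m_def using cINF_less_iff[OF ne bdd] by blast
  qed
  then obtain p where p: "\<And>n. p n \<in> D n" "\<And>n. (norm (p n))\<^sup>2 < m n + 1 / real (Suc n)"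
    by metis
  have m_mono: "m i \<le> m j" if "i \<le> j" for i j
    unfolding m_def using sub[OF that] ne bdd by (intro cINF_superset_mono) auto
  have m_bdd: "m n \<le> B\<^sup>2" for n
  proof -
    have "p n \<in> D 0" using p(1) sub[of 0 n] by auto
    then have "(norm (p n))\<^sup>2 \<le> B\<^sup>2" using B by (intro power_mono) auto
    then show ?thesis using m_le[OF p(1)[of n]] by simp
  qed
  obtain M where M: "m \<longlonglongrightarrow> M"
    using incseq_convergent[of m "B\<^sup>2"] m_mono m_bdd unfolding incseq_def by metis
  have m_le_M: "m n \<le> M" for n
    using M m_mono by (intro incseq_le) (auto simp: incseq_def)
  have est: "(norm (p i - p j))\<^sup>2 \<le> 4 * (M - m n) + 4 / real (Suc n)" if "n \<le> i" "n \<le> j" for i j n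
  proof -
    have "p i \<in> D n" "p j \<in> D n" using p(1) sub that by blast+
    then have "(1/2) *\<^sub>R p i + (1/2) *\<^sub>R p j \<in> D n"
      using cv[of n] by (intro convexD) auto
    then have "m n \<le> (norm ((1/2) *\<^sub>R p i + (1/2) *\<^sub>R p j))\<^sup>2" by (rule m_le)
    also have "\<dots> = ((norm (p i))\<^sup>2 + (norm (p j))\<^sup>2) / 2 - (norm (p i - p j))\<^sup>2 / 4"
      by (simp add: power2_norm_eq_inner inner_simps inner_commute field_simps)
    finally have *: "(norm (p i - p j))\<^sup>2 \<le> 2 * (norm (p i))\<^sup>2 + 2 * (norm (p j))\<^sup>2 - 4 * m n"
      by (simp add: field_simps)
    have "1 / real (Suc i) \<le> 1 / real (Suc n)" "1 / real (Suc j) \<le> 1 / real (Suc n)"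
      using that by (auto simp: frac_le)
    then have "(norm (p i))\<^sup>2 \<le> M + 1 / real (Suc n)" "(norm (p j))\<^sup>2 \<le> M + 1 / real (Suc n)"
      using p(2)[of i] p(2)[of j] m_le_M[of i] m_le_M[of j] by linarith+
    then show ?thesis using * by (simp add: algebra_simps)
  qed
  have lim0: "(\<lambda>n. 4 * (M - m n) + 4 / real (Suc n)) \<longlonglongrightarrow> 0"
  proof -
    have "(\<lambda>n. 4 / real (Suc n)) \<longlonglongrightarrow> 0"
      using LIMSEQ_Suc[OF lim_const_over_n[of "4::real"]] by simp
    from tendsto_add[OF tendsto_mult[OF tendsto_const[of 4] tendsto_diff[OF tendsto_const[of M] M]] this]
    show ?thesis by simp
  qed
  have "Cauchy p"
  proof (rule metric_CauchyI)
    fix e :: real assume e: "e > 0"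
    then have "\<forall>\<^sub>F n in sequentially. 4 * (M - m n) + 4 / real (Suc n) < e\<^sup>2"
      using order_tendstoD(2)[OF lim0, of "e\<^sup>2"] by simp
    then obtain N where N: "4 * (M - m N) + 4 / real (Suc N) < e\<^sup>2"
      by (auto simp: eventually_sequentially)
    show "\<exists>N. \<forall>i\<ge>N. \<forall>j\<ge>N. dist (p i) (p j) < e"
    proof (intro exI allI impI)
      fix i j assume "i \<ge> N" "j \<ge> N"
      then have "(norm (p i - p j))\<^sup>2 < e\<^sup>2" using est[of N i j] N by simp
      then show "dist (p i) (p j) < e" using e by (simp add: dist_norm power2_less_imp_less)
    qed
  qed
  then obtain q where q: "p \<longlonglongrightarrow> q" by (auto simp: Cauchy_convergent_iff convergent_def)
  have "q \<in> D n" for n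
  proof (rule Lim_in_closed_set[OF cl _ _ q])
    show "\<forall>\<^sub>F k in sequentially. p k \<in> D n"
      using p(1) sub unfolding eventually_sequentially by blast
  qed simp
  then show ?thesis by blast
qed

text \<open>
  The candidate for a weak limit is a point common to the closed convex hulls of all tails. Where \<open>s k \<bullet> u\<close> converges to \<open>L\<close>, those hulls lie
  eventually in the strip \<open>\<bar>v \<bullet> u - L\<bar> \<le> e\<close>.
\<close>

lemma ex_common_inner_limit:
  fixes s :: "nat \<Rightarrow> 'a::{real_inner, complete_space}"
  assumes bd: "bounded (range s)"
  obtains w where "w \<in> closure (convex hull (range s))"
    "\<And>u L. (\<lambda>k. s k \<bullet> u) \<longlonglongrightarrow> L \<Longrightarrow> w \<bullet> u = L"
proof -
  define D where "D n = closure (convex hull (s ` {n..}))" for n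
  have "(\<Inter>n. D n) \<noteq> {}"
  proof (rule decseq_bounded_closed_convex_Inter_nonempty)
    show "decseq D"
      unfolding D_def decseq_def by (intro allI impI closure_mono hull_mono image_mono) auto
    show "bounded (D 0)"
      unfolding D_def using bd by (intro bounded_closure bounded_convex_hull) (simp add: atLeast_0)
  qed (auto simp: D_def)
  then obtain w where w: "\<And>n. w \<in> D n" by blast
  show thesis
  proof (rule that)
    show "w \<in> closure (convex hull (range s))"
      using w[of 0] by (simp add: D_def atLeast_0)
    fix u L assume lim: "(\<lambda>k. s k \<bullet> u) \<longlonglongrightarrow> L"
    have "\<bar>w \<bullet> u - L\<bar> \<le> e" if e: "e > 0" for e
    proof -
      obtain n where n: "\<And>k. k \<ge> n \<Longrightarrow> \<bar>s k \<bullet> u - L\<bar> < e"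
        using LIMSEQ_D[OF lim e] unfolding real_norm_def by blast
      define H where "H = {v. u \<bullet> v \<le> L + e} \<inter> {v. u \<bullet> v \<ge> L - e}"
      have H: "v \<in> H \<longleftrightarrow> \<bar>v \<bullet> u - L\<bar> \<le> e" for v
        unfolding H_def inner_commute[of u] by (auto simp: abs_le_iff)
      have "D n \<subseteq> H"
        unfolding D_def
      proof (intro closure_minimal hull_minimal)
        show "s ` {n..} \<subseteq> H" using n by (auto simp: H less_imp_le)
        show "convex H" unfolding H_def by (intro convex_Int convex_halfspace_le convex_halfspace_ge)
        show "closed H" unfolding H_def by (intro closed_Int closed_halfspace_le closed_halfspace_ge)
      qed
      then show ?thesis using w[of n] H by blast
    qed
    then have "\<bar>w \<bullet> u - L\<bar> \<le> 0" by (metis field_le_epsilon add_0)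
    then show "w \<bullet> u = L" by simp
  qed
qed

lemma not_tendsto_subseq_other_limit:
  fixes a :: "nat \<Rightarrow> real"
  assumes bd: "bounded (range a)" and nl: "\<not> a \<longlonglongrightarrow> L"
  obtains r l where "strict_mono r" "(\<lambda>k. a (r k)) \<longlonglongrightarrow> l" "l \<noteq> L"
proof -
  obtain e where e: "e > 0" "\<not> (\<forall>\<^sub>F k in sequentially. dist (a k) L < e)"
    using nl by (auto simp: tendsto_iff)
  then obtain r :: "nat \<Rightarrow> nat" where r: "strict_mono r" "\<And>k. \<not> dist (a (r k)) L < e"
    using not_eventually_sequentiallyD[OF e(2)] by blast
  have "bounded (range (a \<circ> r))" using bd by (rule bounded_subset) auto
  then obtain l r' where r': "strict_mono r'" "((a \<circ> r) \<circ> r') \<longlonglongrightarrow> l"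
    using bounded_imp_convergent_subsequence by blast
  have "dist l L \<ge> e"
  proof (rule tendsto_lowerbound)
    show "((\<lambda>k. dist (((a \<circ> r) \<circ> r') k) L) \<longlongrightarrow> dist l L) sequentially"
      by (intro tendsto_intros r')
  qed (use r(2) in \<open>auto simp: not_less\<close>)
  then have ne: "l \<noteq> L" using e(1) by auto
  show thesis
  proof (rule that[OF _ _ ne])
    show "strict_mono (r \<circ> r')" using r(1) r'(1) by (rule strict_mono_o)
    show "(\<lambda>k. a ((r \<circ> r') k)) \<longlonglongrightarrow> l" using r'(2) by (simp add: o_def)
  qed
qed

lemma bounded_range_inner:
  fixes x :: "nat \<Rightarrow> 'a::real_inner"
  assumes "bounded (range x)"
  shows "bounded (range (\<lambda>k. x k \<bullet> u))"
  using bounded_linear_image[OF assms bounded_linear_inner_left[of u]]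
  by (simp add: image_image)

text \<open>
  A diagonal argument makes the inner products with each of the countably many vectors \<open>x j\<close> converge.
  Take a common point \<open>w\<close> of the tail hulls of that subsequence. If it were not the weak limit,
  another subsequence would provide a different common point \<open>w'\<close>. But \<open>w - w'\<close> is orthogonal to every
  \<open>x j\<close>, whereas \<open>w\<close> and \<open>w'\<close> are in the closed convex hull of the \<open>x j\<close>; so \<open>w - w'\<close> is orthogonal
  to itself.
\<close>

theorem weakly_convergent_subsequence:
  fixes x :: "nat \<Rightarrow> 'a::{real_inner, complete_space}"
  assumes C: "closed C" "convex C" "range x \<subseteq> C" and bd: "bounded (range x)"
  obtains r l where "strict_mono r" "l \<in> C" "limitin weak_topology (x \<circ> r) l sequentially"
proof -
  obtain B where B: "\<And>k. norm (x k) \<le> B" using bd by (auto simp: bounded_iff)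
  have "norm (x k \<bullet> u) \<le> B * B" if "u \<in> range x" for k u
  proof -
    have "\<bar>x k \<bullet> u\<bar> \<le> norm (x k) * norm u" by (rule Cauchy_Schwarz_ineq2)
    also have "\<dots> \<le> B * B"
      using B that by (intro mult_mono) (auto intro: order_trans[OF norm_ge_zero])
    finally show ?thesis by simp
  qed
  then obtain r where r: "strict_mono r"
    and conv: "\<And>u. u \<in> range x \<Longrightarrow> \<exists>L. (\<lambda>k. x (r k) \<bullet> u) \<longlonglongrightarrow> L"
    using function_convergent_subsequence[of "range x" "\<lambda>k u. x k \<bullet> u" "B * B"]
    by (metis countable_image countableI_type)
  define s where "s = x \<circ> r"
  have bs: "bounded (range s)" unfolding s_def using bd by (rule bounded_subset) auto
  obtain w where w: "w \<in> closure (convex hull (range s))"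
    "\<And>u L. (\<lambda>k. s k \<bullet> u) \<longlonglongrightarrow> L \<Longrightarrow> w \<bullet> u = L"
    using ex_common_inner_limit[OF bs] by blast
  have hull_s: "closure (convex hull (range s)) \<subseteq> closure (convex hull (range x))"
    unfolding s_def by (intro closure_mono hull_mono) auto
  have "closure (convex hull (range x)) \<subseteq> C"
    using C by (intro closure_minimal hull_minimal)
  then have "w \<in> C" using w(1) hull_s by blast
  have "limitin weak_topology s w sequentially"
    unfolding limitin_weak_topology_iff
  proof (rule ccontr)
    assume "\<not> (\<forall>u. (\<lambda>k. s k \<bullet> u) \<longlonglongrightarrow> w \<bullet> u)"
    then obtain u where u: "\<not> (\<lambda>k. s k \<bullet> u) \<longlonglongrightarrow> w \<bullet> u" by blast
    obtain r' l where r': "strict_mono r'" "(\<lambda>k. s (r' k) \<bullet> u) \<longlonglongrightarrow> l" "l \<noteq> w \<bullet> u"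
      using not_tendsto_subseq_other_limit[OF bounded_range_inner[OF bs] u] by blast
    have "bounded (range (s \<circ> r'))" using bs by (rule bounded_subset) auto
    then obtain w' where w': "w' \<in> closure (convex hull (range (s \<circ> r')))"
      "\<And>u L. (\<lambda>k. (s \<circ> r') k \<bullet> u) \<longlonglongrightarrow> L \<Longrightarrow> w' \<bullet> u = L"
      using ex_common_inner_limit by blast
    have "w' \<bullet> u = l" using w'(2) r'(2) by simp
    have orth: "(w - w') \<bullet> v = 0" if v: "v \<in> range x" for v
    proof -
      obtain L where L: "(\<lambda>k. s k \<bullet> v) \<longlonglongrightarrow> L"
        using conv[OF v] by (auto simp: s_def)
      have "(\<lambda>k. (s \<circ> r') k \<bullet> v) \<longlonglongrightarrow> L"
        using LIMSEQ_subseq_LIMSEQ[OF L r'(1)] by (simp add: o_def)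
      then show ?thesis using w(2)[OF L] w'(2) by (simp add: inner_diff_left)
    qed
    have "closure (convex hull (range x)) \<subseteq> {v. (w - w') \<bullet> v = 0}"
      using orth by (intro closure_minimal hull_minimal convex_hyperplane closed_hyperplane) blast
    moreover have "closure (convex hull (range (s \<circ> r'))) \<subseteq> closure (convex hull (range x))"
      unfolding s_def by (intro closure_mono hull_mono) auto
    ultimately have "(w - w') \<bullet> w = 0" "(w - w') \<bullet> w' = 0"
      using w(1) w'(1) hull_s by blast+
    then have "(w - w') \<bullet> (w - w') = 0" by (simp add: inner_diff_right)
    then show False using \<open>w' \<bullet> u = l\<close> r'(3) by simp
  qed
  then show thesis using that[OF r \<open>w \<in> C\<close>] by (simp add: s_def)
qed

lemma weak_limit_norm_le:
  fixes s :: "nat \<Rightarrow> 'a::real_inner"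
  assumes lim: "limitin weak_topology s l sequentially" and le: "\<And>k. norm (s k) \<le> d"
  shows "norm l \<le> d"
proof -
  have "(\<lambda>k. s k \<bullet> l) \<longlonglongrightarrow> l \<bullet> l"
    using lim by (simp add: limitin_weak_topology_iff)
  moreover have "s k \<bullet> l \<le> d * norm l" for k
    using norm_cauchy_schwarz[of "s k" l] mult_right_mono[OF le[of k] norm_ge_zero[of l]] by linarith
  ultimately have "l \<bullet> l \<le> d * norm l"
    by (intro LIMSEQ_le_const2) auto
  then have "norm l * norm l \<le> d * norm l"
    by (simp only: power2_norm_eq_inner[symmetric] power2_eq_square)
  then show ?thesis
    using order_trans[OF norm_ge_zero le[of 0]] by (cases "l = 0") auto
qed

lemma limitin_weak_of_tendsto:
  assumes "s \<longlonglongrightarrow> l"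
  shows "limitin weak_topology s l sequentially"
  unfolding limitin_weak_topology_iff by (intro allI tendsto_inner assms tendsto_const)

text \<open>
  For two weak cluster points \<open>z\<close>, \<open>z'\<close> in \<open>S\<close> the difference of \<open>\<parallel>x k - z'\<parallel>\<^sup>2\<close> and \<open>\<parallel>x k - z\<parallel>\<^sup>2\<close> is, up to
  a constant, \<open>2 (x k \<bullet> (z - z'))\<close>. As it converges, \<open>z\<close> and \<open>z'\<close> have the same inner product with
  \<open>z - z'\<close>, so they coincide.
\<close>

lemma opial_weak_convergence:
  fixes x :: "nat \<Rightarrow> 'a::{real_inner, complete_space}"
  assumes bd: "bounded (range x)"
    and cluster: "\<And>r z. strict_mono r \<Longrightarrow> limitin weak_topology (x \<circ> r) z sequentially \<Longrightarrow> z \<in> S"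
    and conv: "\<And>z. z \<in> S \<Longrightarrow> convergent (\<lambda>k. norm (x k - z))"
  shows "\<exists>z\<in>S. limitin weak_topology x z sequentially"
proof -
  obtain r z where r: "strict_mono r" and z: "limitin weak_topology (x \<circ> r) z sequentially"
    using weakly_convergent_subsequence[OF closed_UNIV convex_UNIV _ bd] by blast
  have zS: "z \<in> S" using cluster r z .
  have "(\<lambda>k. x k \<bullet> u) \<longlonglongrightarrow> z \<bullet> u" for u
  proof (rule ccontr)
    assume "\<not> (\<lambda>k. x k \<bullet> u) \<longlonglongrightarrow> z \<bullet> u"
    then obtain r1 l where r1: "strict_mono r1" "(\<lambda>k. x (r1 k) \<bullet> u) \<longlonglongrightarrow> l" "l \<noteq> z \<bullet> u"
      using not_tendsto_subseq_other_limit[OF bounded_range_inner[OF bd]] by blast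
    have "bounded (range (x \<circ> r1))" using bd by (rule bounded_subset) auto
    then obtain r2 z' where r2: "strict_mono r2" and "limitin weak_topology ((x \<circ> r1) \<circ> r2) z' sequentially"
      using weakly_convergent_subsequence[OF closed_UNIV convex_UNIV] by blast
    then have z': "limitin weak_topology (x \<circ> (r1 \<circ> r2)) z' sequentially" by (simp add: o_assoc)
    have mono: "strict_mono (r1 \<circ> r2)" using r1(1) r2 by (rule strict_mono_o)
    have z'S: "z' \<in> S" using cluster[OF mono z'] .
    have "(\<lambda>k. x (r1 (r2 k)) \<bullet> u) \<longlonglongrightarrow> z' \<bullet> u"
      using z' by (simp add: limitin_weak_topology_iff)
    moreover have "(\<lambda>k. x (r1 (r2 k)) \<bullet> u) \<longlonglongrightarrow> l"
      using LIMSEQ_subseq_LIMSEQ[OF r1(2) r2] by (simp add: o_def)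
    ultimately have "z' \<noteq> z" using r1(3) LIMSEQ_unique by blast
    obtain a b where "(\<lambda>k. norm (x k - z)) \<longlonglongrightarrow> a" "(\<lambda>k. norm (x k - z')) \<longlonglongrightarrow> b"
      using conv[OF zS] conv[OF z'S] unfolding convergent_def by blast
    then have "(\<lambda>k. ((norm (x k - z'))\<^sup>2 - (norm (x k - z))\<^sup>2 + (norm z)\<^sup>2 - (norm z')\<^sup>2) / 2)
        \<longlonglongrightarrow> (b\<^sup>2 - a\<^sup>2 + (norm z)\<^sup>2 - (norm z')\<^sup>2) / 2"
      by (intro tendsto_intros) auto
    moreover have "((norm (x k - z'))\<^sup>2 - (norm (x k - z))\<^sup>2 + (norm z)\<^sup>2 - (norm z')\<^sup>2) / 2
        = x k \<bullet> (z - z')" for k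
      by (simp add: power2_norm_eq_inner inner_simps inner_commute)
    ultimately obtain c where c: "(\<lambda>k. x k \<bullet> (z - z')) \<longlonglongrightarrow> c" by auto
    have "(\<lambda>k. x (r k) \<bullet> (z - z')) \<longlonglongrightarrow> c"
      using LIMSEQ_subseq_LIMSEQ[OF c r] by (simp add: o_def)
    moreover have "(\<lambda>k. x (r k) \<bullet> (z - z')) \<longlonglongrightarrow> z \<bullet> (z - z')"
      using z by (simp add: limitin_weak_topology_iff)
    ultimately have 1: "z \<bullet> (z - z') = c" using LIMSEQ_unique by blast
    have "(\<lambda>k. x (r1 (r2 k)) \<bullet> (z - z')) \<longlonglongrightarrow> c"
      using LIMSEQ_subseq_LIMSEQ[OF c mono] by (simp add: o_def)
    moreover have "(\<lambda>k. x (r1 (r2 k)) \<bullet> (z - z')) \<longlonglongrightarrow> z' \<bullet> (z - z')"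
      using z' by (simp add: limitin_weak_topology_iff)
    ultimately have "z' \<bullet> (z - z') = c" using LIMSEQ_unique by blast
    with 1 have "(z - z') \<bullet> (z - z') = 0" by (simp add: inner_diff_left)
    then show False using \<open>z' \<noteq> z\<close> by simp
  qed
  then show ?thesis using zS limitin_weak_topology_iff by blast
qed

lemma weakly_usc_on_eventually_less:
  assumes usc: "weakly_usc_on C \<phi>" and "\<And>k. s k \<in> C" "l \<in> C"
    and lim: "limitin weak_topology s l sequentially" and "\<phi> l < a"
  shows "\<forall>\<^sub>F k in sequentially. \<phi> (s k) < a"
proof -
  obtain T where T: "openin weak_topology T" "{v \<in> C. \<phi> v < a} = T \<inter> C"
    using usc unfolding weakly_usc_on_def openin_subtopology by metis
  have "l \<in> T" using T assms by blast
  then have "\<forall>\<^sub>F k in sequentially. s k \<in> T" using lim T(1) by (auto simp: limitin_def)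
  then show ?thesis by (rule eventually_mono) (use T(2) assms(2) in blast)
qed

section \<open>Real sequences\<close>

text \<open>
  Subtracting the partial sums of \<open>b\<close> from \<open>a\<close> leaves a decreasing sequence that is bounded below.
\<close>

lemma quasi_fejer:
  fixes a b c :: "nat \<Rightarrow> real"
  assumes a: "\<And>k. a k \<ge> 0" and c: "\<And>k. c k \<ge> 0" and b: "\<And>k. b k \<ge> 0" "summable b"
    and step: "\<And>k. a (Suc k) \<le> a k + b k - c k"
  shows "convergent a" "summable c"
proof -
  define B where "B n = (\<Sum>k<n. b k)" for n
  have B: "convergent B" using b(2) unfolding B_def by (simp only: summable_iff_convergent)
  have B_le: "B n \<le> suminf b" for n
    unfolding B_def using b by (intro sum_le_suminf) auto
  have "decseq (\<lambda>n. a n - B n)"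
    unfolding decseq_Suc_iff
  proof
    fix n
    show "a (Suc n) - B (Suc n) \<le> a n - B n"
      using step[of n] c[of n] by (simp add: B_def)
  qed
  moreover have "- suminf b \<le> a n - B n" for n using a[of n] B_le[of n] by linarith
  ultimately obtain l where "(\<lambda>n. a n - B n) \<longlonglongrightarrow> l"
    using decseq_convergent[of "\<lambda>n. a n - B n" "- suminf b"] by blast
  then have "convergent (\<lambda>n. a n - B n)" by (rule convergentI)
  from convergent_add[OF this B] show "convergent a" by simp
  have "a n + (\<Sum>k<n. c k) \<le> a 0 + B n" for n
  proof (induction n)
    case (Suc n)
    then show ?case using step[of n] by (simp add: B_def)
  qed (simp add: B_def)
  then have le: "a n + (\<Sum>k<n. c k) \<le> a 0 + B n" for n .
  have "(\<Sum>k<n. c k) \<le> a 0 + suminf b" for n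
    using le[of n] a[of n] B_le[of n] by linarith
  then show "summable c"
    using c by (intro summableI_nonneg_bounded)
qed

lemma dist_le_sum_steps:
  fixes x :: "nat \<Rightarrow> 'a::metric_space"
  assumes "\<And>k. dist (x (Suc k)) (x k) \<le> b k" "n \<le> m"
  shows "dist (x m) (x n) \<le> (\<Sum>k=n..<m. b k)"
  using assms(2)
proof (induction m rule: dec_induct)
  case (step m)
  have "dist (x (Suc m)) (x n) \<le> dist (x (Suc m)) (x m) + dist (x m) (x n)" by (rule dist_triangle)
  then show ?case using step assms(1)[of m] by simp
qed simp

text \<open>
  This is Bruck's argument. Let \<open>m\<close> be the first index from \<open>n\<close> on with \<open>d m < \<epsilon>\<close>; it exists because
  \<open>\<Sum>\<beta>\<close> diverges. Since \<open>d \<ge> \<epsilon>\<close> before \<open>m\<close>, the path length \<open>K * sum \<beta> {n..<m}\<close> is at most \<open>K / \<epsilon>\<close>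
  times a tail of the convergent series \<open>\<Sum>\<beta> d\<close>.
\<close>

lemma nearby_small_value:
  fixes x :: "nat \<Rightarrow> 'a::metric_space" and \<beta> d :: "nat \<Rightarrow> real"
  assumes \<beta>: "\<And>k. \<beta> k \<ge> 0" "\<not> summable \<beta>" and d: "\<And>k. d k \<ge> 0" "summable (\<lambda>k. \<beta> k * d k)"
    and x: "\<And>k. dist (x (Suc k)) (x k) \<le> K * \<beta> k" and "K > 0" "\<epsilon> > 0" "\<delta> > 0"
  shows "\<exists>N. \<forall>n\<ge>N. \<exists>m\<ge>n. d m < \<epsilon> \<and> dist (x m) (x n) \<le> \<delta>"
proof -
  obtain N where N: "\<And>m n. m \<ge> N \<Longrightarrow> norm (\<Sum>k=m..<n. \<beta> k * d k) < \<epsilon> * (\<delta> / K)"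
    using d(2) \<open>K > 0\<close> \<open>\<epsilon> > 0\<close> \<open>\<delta> > 0\<close> unfolding summable_Cauchy
    by (meson divide_pos_pos mult_pos_pos)
  have "\<exists>m\<ge>n. d m < \<epsilon> \<and> dist (x m) (x n) \<le> \<delta>" if n: "n \<ge> N" for n
  proof -
    have "\<exists>m\<ge>n. d m < \<epsilon>"
    proof (rule ccontr)
      assume *: "\<not> ?thesis"
      have "summable \<beta>"
      proof (rule summable_comparison_test')
        show "summable (\<lambda>k. (\<beta> k * d k) / \<epsilon>)" using d(2) by (rule summable_divide)
        fix k assume "k \<ge> n"
        then have "\<beta> k * \<epsilon> \<le> \<beta> k * d k" using * \<beta>(1) by (intro mult_left_mono) (auto simp: not_less)
        then show "norm (\<beta> k) \<le> (\<beta> k * d k) / \<epsilon>" using \<open>\<epsilon> > 0\<close> \<beta>(1)[of k] by (simp add: field_simps)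
      qed
      then show False using \<beta>(2) by simp
    qed
    then obtain m where m: "m \<ge> n" "d m < \<epsilon>" "\<And>k. k \<ge> n \<Longrightarrow> d k < \<epsilon> \<Longrightarrow> m \<le> k"
      using exists_least_iff[of "\<lambda>m. m \<ge> n \<and> d m < \<epsilon>"] by (metis not_le)
    have "\<epsilon> * (\<Sum>k=n..<m. \<beta> k) \<le> (\<Sum>k=n..<m. \<beta> k * d k)"
      unfolding sum_distrib_left
    proof (rule sum_mono)
      fix k assume "k \<in> {n..<m}"
      then have "\<epsilon> \<le> d k" using m(3)[of k] by force
      then show "\<epsilon> * \<beta> k \<le> \<beta> k * d k"
        using mult_left_mono[OF _ \<beta>(1)[of k], of \<epsilon> "d k"] by (simp add: mult.commute)
    qed
    also have "\<dots> < \<epsilon> * (\<delta> / K)" using N[OF n, of m] by (simp add: abs_less_iff)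
    finally have "(\<Sum>k=n..<m. \<beta> k) < \<delta> / K" using \<open>\<epsilon> > 0\<close> by (simp only: mult_less_cancel_left_pos)
    then have "K * (\<Sum>k=n..<m. \<beta> k) \<le> \<delta>" using \<open>K > 0\<close> by (simp add: field_simps)
    then show ?thesis
      using m dist_le_sum_steps[where b = "\<lambda>k. K * \<beta> k", OF x m(1)]
      by (intro exI[of _ m]) (simp add: sum_distrib_left)
  qed
  then show ?thesis by blast
qed

section \<open>One step of the algorithm\<close>

text \<open>
  Compare \<open>p\<close> with the points \<open>(1 - t) p + t u\<close>: convexity bounds \<open>\<phi>\<close> there linearly in \<open>t\<close>, the quadratic
  term changes by \<open>- t ((a - p) \<bullet> (u - p)) + O(t\<^sup>2)\<close>. Divide by \<open>t\<close> and let \<open>t\<close> tend to \<open>0\<close>. The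
  real-valued \<open>\<psi>\<close> stands for the finite values of \<open>\<phi>\<close> on \<open>C\<close>.
\<close>

lemma prox_inequality:
  fixes \<phi> :: "'a::real_inner \<Rightarrow> ereal"
  assumes C: "convex C" and \<phi>: "convex_fun \<phi>" and fin: "\<And>u. u \<in> C \<Longrightarrow> \<phi> u = ereal (\<psi> u)"
    and lam: "lam \<ge> 0"
    and p: "is_arg_min (\<lambda>u. ereal lam * \<phi> u + ereal (1 / 2 * (norm (u - a))\<^sup>2)) (\<lambda>u. u \<in> C) p"
    and u: "u \<in> C"
  shows "(a - p) \<bullet> (u - p) \<le> lam * (\<psi> u - \<psi> p)"
proof -
  have pC: "p \<in> C" using p by (simp add: is_arg_min_def)
  let ?R = "lam * (\<psi> u - \<psi> p) - (a - p) \<bullet> (u - p)"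
  have *: "0 \<le> ?R + t * (1 / 2 * (norm (u - p))\<^sup>2)" if t: "0 < t" "t < 1" for t
  proof -
    let ?q = "(1 - t) *\<^sub>R p + t *\<^sub>R u"
    have qC: "?q \<in> C" using C pC u t by (auto simp: convex_alt)
    have "\<phi> ?q \<le> ereal (1 - t) * \<phi> p + ereal t * \<phi> u"
      using \<phi> t unfolding convex_fun_def by simp
    then have "\<psi> ?q \<le> (1 - t) * \<psi> p + t * \<psi> u"
      using fin pC u qC by simp
    then have cv: "lam * \<psi> ?q \<le> lam * ((1 - t) * \<psi> p + t * \<psi> u)"
      using lam by (rule mult_left_mono)
    have "\<not> ereal lam * \<phi> ?q + ereal (1 / 2 * (norm (?q - a))\<^sup>2)
          < ereal lam * \<phi> p + ereal (1 / 2 * (norm (p - a))\<^sup>2)"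
      using p qC unfolding is_arg_min_def by blast
    then have "lam * \<psi> p + 1 / 2 * (norm (p - a))\<^sup>2 \<le> lam * \<psi> ?q + 1 / 2 * (norm (?q - a))\<^sup>2"
      using fin pC qC by simp
    also have "(norm (?q - a))\<^sup>2 = (norm (p - a))\<^sup>2 - 2 * t * ((a - p) \<bullet> (u - p)) + t\<^sup>2 * (norm (u - p))\<^sup>2"
      unfolding power2_norm_eq_inner
      by (simp add: inner_simps inner_commute algebra_simps power2_eq_square)
    finally have "0 \<le> t * (?R + t * (1 / 2 * (norm (u - p))\<^sup>2))"
      using cv by (simp add: algebra_simps power2_eq_square)
    then show ?thesis using t(1) by (simp add: zero_le_mult_iff)
  qed
  have "((\<lambda>t. ?R + t * (1 / 2 * (norm (u - p))\<^sup>2)) \<longlongrightarrow> ?R + 0 * (1 / 2 * (norm (u - p))\<^sup>2)) (at_right 0)"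
    by (intro tendsto_intros)
  moreover have "\<forall>\<^sub>F t in at_right 0. 0 \<le> ?R + t * (1 / 2 * (norm (u - p))\<^sup>2)"
    using eventually_at_right_real[of 0 "1::real"] by (rule eventually_mono) (use * in auto)
  ultimately have "0 \<le> ?R + 0 * (1 / 2 * (norm (u - p))\<^sup>2)"
    by (intro tendsto_lowerbound) auto
  then show ?thesis by simp
qed

lemma subgradient_lower_bound:
  fixes \<phi> :: "'a::real_inner \<Rightarrow> ereal"
  assumes g: "g \<in> subdiff \<phi> a" and fin: "\<And>u. u \<in> C \<Longrightarrow> \<phi> u = ereal (\<psi> u)"
    and "a \<in> C" "\<psi> a = 0" "v \<in> C" and lam: "lam \<ge> 0" "lam * norm g \<le> b"
  shows "- (b * norm (v - a)) \<le> lam * \<psi> v"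
proof -
  have "\<phi> a + ereal (g \<bullet> (v - a)) \<le> \<phi> v" using g by (simp add: subdiff_def)
  then have "g \<bullet> (v - a) \<le> \<psi> v" using assms by simp
  then have 1: "lam * (g \<bullet> (v - a)) \<le> lam * \<psi> v" using lam(1) by (rule mult_left_mono)
  have "- (norm g * norm (v - a)) \<le> g \<bullet> (v - a)"
    using Cauchy_Schwarz_ineq2[of g "v - a"] by linarith
  then have "lam * - (norm g * norm (v - a)) \<le> lam * (g \<bullet> (v - a))"
    using lam(1) by (rule mult_left_mono)
  moreover have "lam * norm g * norm (v - a) \<le> b * norm (v - a)"
    using lam(2) by (rule mult_right_mono) simp
  ultimately show ?thesis using 1 by (simp add: mult.assoc)
qed

text \<open>
  The step length follows from the proximal inequalities at \<open>u = a\<close>, which give \<open>\<parallel>p - a\<parallel> \<le> b\<close> first. For the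
  other claim, expand \<open>\<parallel>q - u\<parallel>\<^sup>2\<close> along \<open>a\<close>, \<open>p\<close>, \<open>q\<close>; the two negative squares absorb the terms
  linear in \<open>\<parallel>p - a\<parallel>\<close> and \<open>\<parallel>q - p\<parallel>\<close> up to \<open>5 b\<^sup>2\<close>.
\<close>

lemma splitting_step:
  fixes C :: "'a::real_inner set" and \<phi>1 \<phi>2 :: "'a \<Rightarrow> ereal"
  assumes C: "convex C" and cv: "convex_fun \<phi>1" "convex_fun \<phi>2"
    and fin: "\<And>u. u \<in> C \<Longrightarrow> \<phi>1 u = ereal (\<psi>1 u)" "\<And>u. u \<in> C \<Longrightarrow> \<phi>2 u = ereal (\<psi>2 u)"
    and a: "a \<in> C" "\<psi>1 a = 0" "\<psi>2 a = 0"
    and g: "g1 \<in> subdiff \<phi>1 a" "g2 \<in> subdiff \<phi>2 a"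
    and lam: "lam \<ge> 0" "lam * norm g1 \<le> b" "lam * norm g2 \<le> b"
    and p: "is_arg_min (\<lambda>u. ereal lam * \<phi>1 u + ereal (1 / 2 * (norm (u - a))\<^sup>2)) (\<lambda>u. u \<in> C) p"
    and q: "is_arg_min (\<lambda>u. ereal lam * \<phi>2 u + ereal (1 / 2 * (norm (u - p))\<^sup>2)) (\<lambda>u. u \<in> C) q"
  shows "norm (q - a) \<le> 2 * b"
    and "u \<in> C \<Longrightarrow> (norm (q - u))\<^sup>2 \<le> (norm (a - u))\<^sup>2 + 2 * lam * (\<psi>1 u + \<psi>2 u) + 5 * b\<^sup>2"
proof -
  have pC: "p \<in> C" and qC: "q \<in> C" using p q by (simp_all add: is_arg_min_def)
  have b: "b \<ge> 0" using lam by (meson mult_nonneg_nonneg norm_ge_zero order_trans)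
  note P = prox_inequality[OF C cv(1) fin(1) lam(1) p, simplified]
  note Q = prox_inequality[OF C cv(2) fin(2) lam(1) q, simplified]
  have lb1: "- (b * norm (p - a)) \<le> lam * \<psi>1 p"
    using subgradient_lower_bound[OF g(1) fin(1) a(1,2) pC lam(1,2)] .
  have lb2: "- (b * norm (q - a)) \<le> lam * \<psi>2 q"
    using subgradient_lower_bound[OF g(2) fin(2) a(1,3) qC lam(1,3)] .
  have "(norm (p - a))\<^sup>2 = (a - p) \<bullet> (a - p)"
    by (simp add: power2_norm_eq_inner norm_minus_commute[of p a])
  also have "\<dots> \<le> b * norm (p - a)" using P[OF a(1)] lb1 a by simp
  finally have "norm (p - a) * norm (p - a) \<le> b * norm (p - a)" by (simp add: power2_eq_square)
  then have pa: "norm (p - a) \<le> b" using b by (cases "p = a") auto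
  have "(norm (q - a))\<^sup>2 = (p - q) \<bullet> (a - q) + (p - a) \<bullet> (q - a)"
    unfolding power2_norm_eq_inner by (simp add: inner_simps inner_commute)
  also have "\<dots> \<le> b * norm (q - a) + b * norm (q - a)"
    using Q[OF a(1)] lb2 a norm_cauchy_schwarz[of "p - a" "q - a"]
      mult_right_mono[OF pa norm_ge_zero[of "q - a"]] by simp
  finally have "norm (q - a) * norm (q - a) \<le> (2 * b) * norm (q - a)"
    by (simp add: power2_eq_square)
  then show "norm (q - a) \<le> 2 * b" using b by (cases "q = a") auto
  assume u: "u \<in> C"
  have "(norm (q - u))\<^sup>2 = (norm (a - u))\<^sup>2 + 2 * ((a - p) \<bullet> (u - p)) + 2 * ((p - q) \<bullet> (u - q))
      - (norm (p - a))\<^sup>2 - (norm (q - p))\<^sup>2"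
    unfolding power2_norm_eq_inner by (simp add: inner_simps inner_commute)
  also have "\<dots> \<le> (norm (a - u))\<^sup>2 + 2 * (lam * (\<psi>1 u - \<psi>1 p)) + 2 * (lam * (\<psi>2 u - \<psi>2 q))
      - (norm (p - a))\<^sup>2 - (norm (q - p))\<^sup>2"
    using P[OF u] Q[OF u] by linarith
  also have "\<dots> \<le> (norm (a - u))\<^sup>2 + 2 * lam * (\<psi>1 u + \<psi>2 u) + 2 * (b * norm (p - a)) + 2 * (b * norm (q - a))
      - (norm (p - a))\<^sup>2 - (norm (q - p))\<^sup>2"
    using lb1 lb2 by (simp add: algebra_simps)
  also have "\<dots> \<le> (norm (a - u))\<^sup>2 + 2 * lam * (\<psi>1 u + \<psi>2 u) + 5 * b\<^sup>2"
  proof -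
    have "norm (q - a) \<le> norm (q - p) + norm (p - a)"
      using norm_triangle_ineq[of "q - p" "p - a"] by simp
    then have "b * norm (q - a) \<le> b * (norm (q - p) + norm (p - a))"
      using b by (rule mult_left_mono)
    \<comment> \<open>With \<open>s = \<parallel>p - a\<parallel>\<close> and \<open>t = \<parallel>q - p\<parallel>\<close> the excess is at most
      \<open>4bs - s\<^sup>2 + 2bt - t\<^sup>2\<close>; completing the squares gives \<open>4b\<^sup>2 + b\<^sup>2\<close>.\<close>
    moreover have "0 \<le> (norm (p - a) - 2 * b)\<^sup>2 + (norm (q - p) - b)\<^sup>2" by simp
    ultimately show ?thesis by (simp add: power2_eq_square algebra_simps)
  qed
  finally show "(norm (q - u))\<^sup>2 \<le> (norm (a - u))\<^sup>2 + 2 * lam * (\<psi>1 u + \<psi>2 u) + 5 * b\<^sup>2" .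
qed

section \<open>Convergence of the splitting algorithm\<close>

theorem theorem1:
  fixes C :: "'a::{real_inner, complete_space} set"
    and f f1 f2 :: "'a \<Rightarrow> 'a \<Rightarrow> ereal"
    and \<beta> \<eta> lam :: "nat \<Rightarrow> real"
    and x y g1 g2 :: "nat \<Rightarrow> 'a"
  assumes C: "C \<noteq> {}" "closed C" "convex C"
    and f_eq: "f = (\<lambda>u v. f1 u v + f2 u v)"
    and not_MInf: "\<And>u v. f1 u v \<noteq> - \<infinity>" "\<And>u v. f2 u v \<noteq> - \<infinity>"
    and finite_on: "\<And>u v. u \<in> C \<Longrightarrow> v \<in> C \<Longrightarrow> f1 u v \<noteq> \<infinity>"
                   "\<And>u v. u \<in> C \<Longrightarrow> v \<in> C \<Longrightarrow> f2 u v \<noteq> \<infinity>"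
    and diag: "\<And>u. u \<in> C \<Longrightarrow> f1 u u = 0" "\<And>u. u \<in> C \<Longrightarrow> f2 u u = 0"
    and solvable: "EP_solutions C f \<noteq> {}"
    and A1_convex: "\<And>u. u \<in> C \<Longrightarrow> convex_fun (f1 u)" "\<And>u. u \<in> C \<Longrightarrow> convex_fun (f2 u)"
    and A1_subdiff: "\<And>u. u \<in> C \<Longrightarrow> subdifferentiable_on C (f1 u)"
                    "\<And>u. u \<in> C \<Longrightarrow> subdifferentiable_on C (f2 u)"
    and A1_usc: "\<And>v. v \<in> C \<Longrightarrow> weakly_usc_on C (\<lambda>u. f u v)"
    and A2: "\<And>(z :: nat \<Rightarrow> 'a) g. range z \<subseteq> C \<Longrightarrow> bounded (range z) \<Longrightarrow>
               (\<And>k. g k \<in> subdiff (f1 (z k)) (z k)) \<Longrightarrow> bounded (range g)"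
            "\<And>(z :: nat \<Rightarrow> 'a) g. range z \<subseteq> C \<Longrightarrow> bounded (range z) \<Longrightarrow>
               (\<And>k. g k \<in> subdiff (f2 (z k)) (z k)) \<Longrightarrow> bounded (range g)"
    and A3: "monotone_bifun C f"
    and para: "paramonotone C (EP_solutions C f) f"
    and qualification: "interior C \<noteq> {} \<or>
           (\<forall>u\<in>C. (\<exists>v\<in>C. isCont (f1 u) v) \<and> (\<exists>v\<in>C. isCont (f2 u) v))"
    and \<beta>_pos: "\<And>k. \<beta> k > 0"
    and \<beta>_sum: "filterlim (\<lambda>n. \<Sum>k<n. \<beta> k) at_top sequentially"
    and \<beta>_square_sum: "summable (\<lambda>k. (\<beta> k)\<^sup>2)"
    and x_0: "x 0 \<in> C"
    and g1: "\<And>k. g1 k \<in> subdiff (f1 (x k)) (x k)"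
    and g2: "\<And>k. g2 k \<in> subdiff (f2 (x k)) (x k)"
    and \<eta>: "\<And>k. \<eta> k = Max {\<beta> k, norm (g1 k), norm (g2 k)}"
    and lam: "\<And>k. lam k = \<beta> k / \<eta> k"
    and y_step: "\<And>k. is_arg_min
           (\<lambda>u. ereal (lam k) * f1 (x k) u + ereal (1 / 2 * (norm (u - x k))\<^sup>2)) (\<lambda>u. u \<in> C) (y k)"
    and x_step: "\<And>k. is_arg_min
           (\<lambda>u. ereal (lam k) * f2 (x k) u + ereal (1 / 2 * (norm (u - y k))\<^sup>2)) (\<lambda>u. u \<in> C) (x (Suc k))"
  shows "(\<exists>z \<in> EP_solutions C f. limitin weak_topology x z sequentially) \<and>
         (strongly_pseudomonotone C f \<longrightarrow>
            (\<exists>z. EP_solutions C f = {z} \<and> x \<longlonglongrightarrow> z))"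
proof -
  define \<psi>1 where "\<psi>1 k u = real_of_ereal (f1 (x k) u)" for k u
  define \<psi>2 where "\<psi>2 k u = real_of_ereal (f2 (x k) u)" for k u
  have xC: "x k \<in> C" for k
    using x_0 x_step by (cases k) (auto simp: is_arg_min_def)
  have fin1: "f1 (x k) u = ereal (\<psi>1 k u)" if "u \<in> C" for k u
    using finite_on(1)[OF xC that, of k] not_MInf(1)[of "x k" u] unfolding \<psi>1_def
    by (cases "f1 (x k) u") auto
  have fin2: "f2 (x k) u = ereal (\<psi>2 k u)" if "u \<in> C" for k u
    using finite_on(2)[OF xC that, of k] not_MInf(2)[of "x k" u] unfolding \<psi>2_def
    by (cases "f2 (x k) u") auto
  have f_real: "f (x k) u = ereal (\<psi>1 k u + \<psi>2 k u)" if "u \<in> C" for k u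
    using fin1 fin2 that by (simp add: f_eq)
  have \<psi>_diag: "\<psi>1 k (x k) = 0" "\<psi>2 k (x k) = 0" for k
    using diag[OF xC] by (simp_all add: \<psi>1_def \<psi>2_def)
  have \<eta>_ge: "\<beta> k \<le> \<eta> k" "norm (g1 k) \<le> \<eta> k" "norm (g2 k) \<le> \<eta> k" for k
    by (simp_all add: \<eta>)
  have \<eta>_pos: "\<eta> k > 0" for k using \<eta>_ge(1) \<beta>_pos less_le_trans by blast
  have lam_pos: "lam k > 0" for k using \<beta>_pos \<eta>_pos by (simp add: lam)
  have lam_g: "lam k * norm (g1 k) \<le> \<beta> k" "lam k * norm (g2 k) \<le> \<beta> k" for k
    using mult_left_mono[OF \<eta>_ge(2)] mult_left_mono[OF \<eta>_ge(3)] \<beta>_pos[of k] \<eta>_pos[of k]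
    by (simp_all add: lam field_simps)
  have A1_convex': "convex_fun (f1 (x k))" "convex_fun (f2 (x k))" for k
    using A1_convex xC by auto
  note step = splitting_step[OF C(3) A1_convex' fin1 fin2 xC \<psi>_diag g1 g2
      less_imp_le[OF lam_pos] lam_g y_step x_step]

  let ?S = "EP_solutions C f"
  define d where "d z k = - (\<psi>1 k z + \<psi>2 k z)" for z k
  have S_C: "z \<in> C" if "z \<in> ?S" for z using that by (simp add: EP_solutions_def)
  have d_eq: "f (x k) z = ereal (- d z k)" if "z \<in> ?S" for z k
    using f_real[OF S_C[OF that]] by (simp add: d_def)
  have d_nonneg: "d z k \<ge> 0" if z: "z \<in> ?S" for z k
  proof -
    have "f (x k) z + f z (x k) \<le> 0" "f z (x k) \<ge> 0"
      using A3 z xC by (auto simp: monotone_bifun_def EP_solutions_def)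
    then show ?thesis using d_eq[OF z] by (cases "f z (x k)") auto
  qed
  have fejer: "(norm (x (Suc k) - z))\<^sup>2 \<le> (norm (x k - z))\<^sup>2 + 5 * (\<beta> k)\<^sup>2 - 2 * lam k * d z k"
    if z: "z \<in> ?S" for z k
    using step(2)[OF _ _ S_C[OF z]] by (simp add: d_def algebra_simps)
  have sum5: "summable (\<lambda>k. 5 * (\<beta> k)\<^sup>2)" using \<beta>_square_sum by (rule summable_mult)
  have conv_sq: "convergent (\<lambda>k. (norm (x k - z))\<^sup>2)" and sum_lam: "summable (\<lambda>k. 2 * lam k * d z k)"
    if z: "z \<in> ?S" for z
    using quasi_fejer[of "\<lambda>k. (norm (x k - z))\<^sup>2" "\<lambda>k. 2 * lam k * d z k" "\<lambda>k. 5 * (\<beta> k)\<^sup>2",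
        OF _ _ _ sum5 fejer[OF z]] lam_pos d_nonneg[OF z]
    by (simp_all add: less_imp_le)
  have conv: "convergent (\<lambda>k. norm (x k - z))" if z: "z \<in> ?S" for z
  proof -
    obtain L where "(\<lambda>k. (norm (x k - z))\<^sup>2) \<longlonglongrightarrow> L"
      using conv_sq[OF z] by (auto simp: convergent_def)
    from tendsto_real_sqrt[OF this] show ?thesis by (auto simp: convergent_def)
  qed
  have bdd: "bounded (range x)"
  proof -
    obtain z where z: "z \<in> ?S" using solvable by blast
    obtain l where "(\<lambda>k. norm (x k - z)) \<longlonglongrightarrow> l"
      using conv[OF z] by (auto simp: convergent_def)
    then have "bounded (range (\<lambda>k. norm (x k - z)))" by (rule convergent_imp_bounded)
    then obtain B where B: "\<And>k. norm (x k - z) \<le> B" by (auto simp: bounded_iff)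
    have "norm (x k) \<le> B + norm z" for k
      using norm_triangle_ineq[of "x k - z" z] B[of k] by simp
    then show ?thesis by (auto simp: bounded_iff)
  qed

  have "bounded (range \<beta>)"
  proof -
    have "(\<lambda>k. sqrt ((\<beta> k)\<^sup>2)) \<longlonglongrightarrow> sqrt 0"
      using summable_LIMSEQ_zero[OF \<beta>_square_sum] by (rule tendsto_real_sqrt)
    then have "\<beta> \<longlonglongrightarrow> 0" using \<beta>_pos by (simp add: less_imp_le)
    then show ?thesis by (rule convergent_imp_bounded)
  qed
  moreover have "bounded (range g1)" "bounded (range g2)"
    using A2(1)[of x g1] A2(2)[of x g2] xC bdd g1 g2 by auto
  ultimately obtain b1 b2 b3
    where b: "\<And>k. \<beta> k \<le> b1" "\<And>k. norm (g1 k) \<le> b2" "\<And>k. norm (g2 k) \<le> b3"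
    by (fastforce simp: bounded_iff abs_le_iff)
  define L where "L = max b1 (max b2 b3)"
  have \<eta>_L: "\<eta> k \<le> L" for k
    unfolding \<eta> L_def using b[of k] by (intro Max.boundedI) (auto simp: le_max_iff_disj)
  have "L > 0" using \<eta>_pos[of 0] \<eta>_L[of 0] by linarith
  have sum_d: "summable (\<lambda>k. \<beta> k * d z k)" if z: "z \<in> ?S" for z
  proof (rule summable_comparison_test')
    show "summable (\<lambda>k. L * (2 * lam k * d z k))" using sum_lam[OF z] by (rule summable_mult)
    fix k
    have "\<beta> k = \<eta> k * lam k" using \<eta>_pos[of k] by (simp add: lam)
    also have "\<dots> \<le> L * (2 * lam k)" using \<eta>_L[of k] lam_pos[of k] \<open>L > 0\<close>
      by (intro mult_mono) auto
    finally have "\<beta> k * d z k \<le> L * (2 * lam k) * d z k"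
      using d_nonneg[OF z] by (rule mult_right_mono)
    then show "norm (\<beta> k * d z k) \<le> L * (2 * lam k * d z k)"
      using \<beta>_pos[of k] d_nonneg[OF z, of k] by (simp add: abs_mult mult.assoc)
  qed
  have \<beta>_div: "\<not> summable \<beta>"
  proof
    assume "summable \<beta>"
    then have "(\<lambda>n. \<Sum>k<n. \<beta> k) \<longlonglongrightarrow> suminf \<beta>" by (rule summable_LIMSEQ)
    then show False
      by (rule not_tendsto_and_filterlim_at_infinity[OF trivial_limit_sequentially _
            filterlim_at_top_imp_at_infinity[OF \<beta>_sum]])
  qed
  have near: "\<exists>N. \<forall>n\<ge>N. \<exists>m\<ge>n. d z m < \<epsilon> \<and> dist (x m) (x n) \<le> \<delta>"
    if "z \<in> ?S" "\<epsilon> > 0" "\<delta> > 0" for z \<epsilon> \<delta>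
    by (rule nearby_small_value[of \<beta> "d z" x 2])
      (use that \<beta>_pos \<beta>_div d_nonneg sum_d step(1) in \<open>auto simp: dist_norm less_imp_le\<close>)

  \<comment> \<open>Strong limits are weak limits, so upper semicontinuity in the first argument applies.\<close>
  have S_closed: "z \<in> ?S" if s: "\<And>k. s k \<in> ?S" and lim: "s \<longlonglongrightarrow> z" for s z
  proof -
    have sC: "s k \<in> C" for k using s S_C by blast
    then have zC: "z \<in> C" using C(2) lim closed_sequentially by blast
    have "f z v \<ge> 0" if v: "v \<in> C" for v
    proof (rule ccontr)
      assume "\<not> f z v \<ge> 0"
      then have "\<forall>\<^sub>F k in sequentially. f (s k) v < 0"
        using weakly_usc_on_eventually_less[OF A1_usc[OF v] sC zC limitin_weak_of_tendsto[OF lim], of 0]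
        by (simp add: not_le)
      then obtain k where "f (s k) v < 0" by (auto simp: eventually_sequentially)
      moreover have "f (s k) v \<ge> 0" using s v by (simp add: EP_solutions_def)
      ultimately show False by simp
    qed
    then show ?thesis using zC by (simp add: EP_solutions_def)
  qed

  \<comment> \<open>If the gap vanishes along a weakly convergent subsequence, upper semicontinuity gives
    \<open>f w z \<ge> 0\<close>; with \<open>f z w \<ge> 0\<close> and monotonicity both values are \<open>0\<close>, and paramonotonicity applies.\<close>
  have cluster_small: "w \<in> ?S"
    if z: "z \<in> ?S" and m: "(\<lambda>i. d z (m i)) \<longlonglongrightarrow> 0"
      and w: "w \<in> C" "limitin weak_topology (\<lambda>i. x (m i)) w sequentially" for z m w
  proof -
    have "f w z \<ge> 0"
    proof (rule ccontr)
      assume "\<not> f w z \<ge> 0"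
      then obtain c where c: "f w z < ereal c" "c < 0"
        using ereal_dense2[of "f w z" 0] by (auto simp: not_le)
      have "\<forall>\<^sub>F i in sequentially. f (x (m i)) z < ereal c"
        using weakly_usc_on_eventually_less[OF A1_usc[OF S_C[OF z]] xC w c(1)] .
      moreover have "\<forall>\<^sub>F i in sequentially. d z (m i) < - c"
        using order_tendstoD(2)[OF m] c(2) by simp
      ultimately have "\<forall>\<^sub>F i in sequentially. False"
        by eventually_elim (simp add: d_eq[OF z])
      then show False by simp
    qed
    moreover have "f z w \<ge> 0" "f w z + f z w \<le> 0"
      using z w A3 S_C[OF z] by (auto simp: EP_solutions_def monotone_bifun_def)
    ultimately have "f z w = 0 \<and> f w z = 0"
      by (cases "f w z"; cases "f z w") (auto simp: zero_ereal_def)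
    then show ?thesis using para z w(1) by (auto simp: paramonotone_def)
  qed

  have cluster: "w \<in> ?S" if r: "strict_mono r" and w: "limitin weak_topology (x \<circ> r) w sequentially" for r w
  proof -
    obtain z where z: "z \<in> ?S" using solvable by blast
    have ex: "\<exists>w'\<in>?S. norm (w' - w) \<le> \<delta>" if \<delta>: "\<delta> > 0" for \<delta>
    proof -
      \<comment> \<open>Replace late terms of the subsequence by \<open>\<delta>\<close>-close iterates with small gap. The bound
        \<open>j \<ge> i\<close> makes \<open>x (r (j i))\<close> inherit the weak limit \<open>w\<close>.\<close>
      have "\<exists>j m. j \<ge> i \<and> d z m < 1 / real (Suc i) \<and> dist (x m) (x (r j)) \<le> \<delta>" for i
      proof -
        obtain N where N: "\<forall>n\<ge>N. \<exists>m\<ge>n. d z m < 1 / real (Suc i) \<and> dist (x m) (x n) \<le> \<delta>"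
          using near[OF z, of "1 / real (Suc i)" \<delta>] \<delta> by auto
        have "r (max i N) \<ge> N" using seq_suble[OF r, of "max i N"] by simp
        then show ?thesis using N by (meson max.cobounded1)
      qed
      then obtain j m where j: "\<And>i. j i \<ge> i" and m: "\<And>i. d z (m i) < 1 / real (Suc i)"
        and dist: "\<And>i. dist (x (m i)) (x (r (j i))) \<le> \<delta>"
        by metis
      have "bounded (range (x \<circ> m))" using bdd by (rule bounded_subset) auto
      then obtain r' w' where r': "strict_mono r'" and w': "w' \<in> C"
        "limitin weak_topology ((x \<circ> m) \<circ> r') w' sequentially"
        using weakly_convergent_subsequence[OF C(2,3), of "x \<circ> m"] xC by auto
      have "(\<lambda>i. d z (m i)) \<longlonglongrightarrow> 0"
      proof (rule tendsto_sandwich[OF _ _ tendsto_const])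
        show "(\<lambda>i. 1 / real (Suc i)) \<longlonglongrightarrow> 0"
          using LIMSEQ_Suc[OF lim_const_over_n[of "1::real"]] by simp
      qed (use d_nonneg[OF z] m in \<open>auto intro!: always_eventually less_imp_le\<close>)
      then have "(\<lambda>i. d z (m (r' i))) \<longlonglongrightarrow> 0"
        using LIMSEQ_subseq_LIMSEQ[OF _ r'] by (simp add: o_def)
      then have "w' \<in> ?S"
        using cluster_small[OF z, of "\<lambda>i. m (r' i)"] w' by (simp add: o_def)
      moreover have "norm (w' - w) \<le> \<delta>"
      proof (rule weak_limit_norm_le)
        have "filterlim (\<lambda>i. j (r' i)) at_top sequentially"
          by (rule filterlim_at_top_mono[OF filterlim_subseq[OF r']]) (auto intro: always_eventually j)
        then have "(\<lambda>i. x (r (j (r' i))) \<bullet> u) \<longlonglongrightarrow> w \<bullet> u" for u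
          using w filterlim_compose[of "\<lambda>k. x (r k) \<bullet> u" "nhds (w \<bullet> u)" sequentially]
          by (auto simp: limitin_weak_topology_iff)
        then show "limitin weak_topology (\<lambda>i. x (m (r' i)) - x (r (j (r' i)))) (w' - w) sequentially"
          using w'(2) by (auto simp: limitin_weak_topology_iff inner_diff_left intro: tendsto_diff)
        show "norm (x (m (r' i)) - x (r (j (r' i)))) \<le> \<delta>" for i
          using dist[of "r' i"] by (simp add: dist_norm)
      qed
      ultimately show ?thesis by blast
    qed
    have "\<exists>w'. w' \<in> ?S \<and> norm (w' - w) \<le> 1 / real (Suc i)" for i
      using ex[of "1 / real (Suc i)"] by auto
    then obtain s where s: "\<And>i. s i \<in> ?S" "\<And>i. norm (s i - w) \<le> 1 / real (Suc i)" by metis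
    have "(\<lambda>i. norm (s i - w)) \<longlonglongrightarrow> 0"
    proof (rule tendsto_sandwich[OF _ _ tendsto_const])
      show "(\<lambda>i. 1 / real (Suc i)) \<longlonglongrightarrow> 0"
        using LIMSEQ_Suc[OF lim_const_over_n[of "1::real"]] by simp
    qed (use s(2) in \<open>auto intro!: always_eventually\<close>)
    then have "s \<longlonglongrightarrow> w" by (simp add: LIM_zero_iff tendsto_norm_zero_iff)
    with s(1) show ?thesis by (rule S_closed)
  qed

  have weak: "\<exists>z\<in>?S. limitin weak_topology x z sequentially"
    using opial_weak_convergence[OF bdd cluster conv] .

  have strong: "\<exists>z. ?S = {z} \<and> x \<longlonglongrightarrow> z" if sp: "strongly_pseudomonotone C f"
  proof -
    obtain \<gamma> where \<gamma>: "\<gamma> > 0"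
      "\<And>u v. u \<in> C \<Longrightarrow> v \<in> C \<Longrightarrow> f u v \<ge> 0 \<Longrightarrow> f v u \<le> ereal (- \<gamma> * (norm (v - u))\<^sup>2)"
      using sp unfolding strongly_pseudomonotone_def by blast
    obtain z where z: "z \<in> ?S" using solvable by blast
    have uniq: "w = z" if w: "w \<in> ?S" for w
    proof -
      have "0 \<le> f w z" "f w z \<le> ereal (- \<gamma> * (norm (w - z))\<^sup>2)"
        using \<gamma>(2)[of z w] z w by (auto simp: EP_solutions_def)
      then have "0 \<le> ereal (- \<gamma> * (norm (w - z))\<^sup>2)" by (rule order_trans)
      then have "\<gamma> * (norm (w - z))\<^sup>2 \<le> 0" by simp
      then show ?thesis using \<gamma>(1) by (simp add: mult_le_0_iff)
    qed
    \<comment> \<open>Strong pseudo-monotonicity between \<open>z\<close> and \<open>x k\<close> bounds the gap below by the squared distance.\<close>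
    have d_ge: "\<gamma> * (norm (x k - z))\<^sup>2 \<le> d z k" for k
    proof -
      have "f z (x k) \<ge> 0" using z xC by (simp add: EP_solutions_def)
      then show ?thesis using \<gamma>(2)[OF S_C[OF z] xC[of k]] d_eq[OF z, of k] by simp
    qed
    obtain l where l: "(\<lambda>k. (norm (x k - z))\<^sup>2) \<longlonglongrightarrow> l"
      using conv_sq[OF z] by (auto simp: convergent_def)
    have "l \<le> e / \<gamma>" if e: "e > 0" for e
    proof (rule ccontr)
      assume "\<not> l \<le> e / \<gamma>"
      then have "\<forall>\<^sub>F k in sequentially. e / \<gamma> < (norm (x k - z))\<^sup>2"
        using order_tendstoD(1)[OF l] by simp
      then obtain N1 where N1: "\<And>k. k \<ge> N1 \<Longrightarrow> e / \<gamma> < (norm (x k - z))\<^sup>2"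
        by (auto simp: eventually_sequentially)
      obtain N2 where N2: "\<And>n. n \<ge> N2 \<Longrightarrow> \<exists>m\<ge>n. d z m < e" using near[OF z e zero_less_one] by blast
      obtain m where "m \<ge> max N1 N2" "d z m < e" using N2[of "max N1 N2"] by auto
      then show False using N1[of m] d_ge[of m] \<gamma>(1) by (simp add: field_simps)
    qed
    from this[of "_ * \<gamma>"] have "l \<le> 0 + e" if "e > 0" for e
      using that \<gamma>(1) by simp
    then have "l \<le> 0" by (rule field_le_epsilon)
    moreover have "l \<ge> 0" using l by (rule LIMSEQ_le_const) auto
    ultimately have "(\<lambda>k. sqrt ((norm (x k - z))\<^sup>2)) \<longlonglongrightarrow> sqrt 0"
      using tendsto_real_sqrt[OF l] by simp
    then have "(\<lambda>k. norm (x k - z)) \<longlonglongrightarrow> 0" by simp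
    then have "x \<longlonglongrightarrow> z" by (simp add: LIM_zero_iff tendsto_norm_zero_iff)
    then show ?thesis using uniq z by blast
  qed
  show ?thesis using weak strong by blast
qed

end
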